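(* Let $f,\mu,u_0$ satisfy assumptions (A1)–(A4) listed in the context, and suppose there exists $\overline h\in\mathbb{R}$ such that $f(\overline h,\mu(D_{\overline h}(0)))\le 0\le f(\overline h,\mu(E_{\overline h}(0)))$. Assume that for any bounded set $A\subset\mathbb{R}^n$ there exists $\Theta_A>0$ such that $\inf_{x\in A}\Theta(x)\ge\Theta_A$, and that $f(\overline h,\cdot)\in C^1([0,\infty))$; write $f_q$ for the derivative of $f$ in its second argument. If there exist $C,s_0>0$ and $0<\sigma<1$ such that $$f_q(\overline h,\mu(D_{\overline h}(0)))>0,\qquad \mathrm{Per}(D_{\overline h}(s))\ge\frac{C}{(-s)^\sigma}\quad\text{for all }-s_0\le s<0,$$ then there exist $0<\alpha<1$ and $C'>0$ such that $\displaystyle\limsup_{s\to0+}\frac{f(\overline h,\mu(D_{\overline h}(-s)))}{s^\alpha}\le-C'$. If there exist $C,s_0>0$ and $0<\sigma<1$ such that $$f_q(\overline h,\mu(E_{\overline h}(0)))>0,\qquad \mathrm{Per}(E_{\overline h}(s))\ge\frac{C}{s^\sigma}\quad\text{for all }0<s\le s_0,$$ then there exist $0<\alpha<1$ and $C'>0$ such that $\displaystyle\liminf_{s\to0+}\frac{f(\overline h,\mu(E_{\overline h}(s)))}{s^\alpha}\ge C'$.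
   Context: Setting. $\mathcal{B}$ is the family of Lebesgue measurable subsets of $\mathbb{R}^n$; $f:\mathbb{R}\times[0,\infty)\to\mathbb{R}$, $\mu:\mathcal{B}\to[0,\infty)$, $u_0:\mathbb{R}^n\to\mathbb{R}$. $\mathrm{Per}(A)$ is the perimeter of $A\subset\mathbb{R}^n$. (A1) $f$ is bounded and continuous, and there is a modulus of continuity $\omega_f$ with $|f(r,q_1)-f(r,q_2)|\le\omega_f(|q_1-q_2|)$ for all $r\in\mathbb{R}$, $q_1,q_2\ge0$. (A2) $f(r_1,q)\le f(r_2,q)$ for $r_1<r_2$, $q\ge0$; and $f(r,q_1)<f(r,q_2)$ for $r\in\mathbb{R}$, $0\le q_1<q_2$. (A3) $\mu(A)=\int_A\Theta(x)\,dx$ for $A\in\mathcal{B}$, where $\Theta\in L^1(\mathbb{R}^n)$, $\Theta>0$ in $\mathbb{R}^n$. (A4) $u_0$ is uniformly continuous and $\lim_{R\to\infty}\inf\{u_0(y):|y|\ge R\}>u_0(x)$ for every $x\in\mathbb{R}^n$. Parallel sets. For $h\in\mathbb{R}$: $D_h(0)=\{u_0<h\}$, $E_h(0)=\{u_0\le h\}$, and for $s\in\mathbb{R}$, $D_h(s)=\{x:\mathrm{sd}(x,D_h(0))<s\}$, $E_h(s)=\{x:\mathrm{sd}(x,E_h(0))\le s\}$, with $\mathrm{sd}(x,A)=\mathrm{dist}(x,A)-\mathrm{dist}(x,\mathbb{R}^n\setminus A)$ and $\mathrm{dist}(x,\emptyset)=+\infty$. *)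

theory Defs
  imports "HOL-Analysis.Analysis"
begin

definition modulus_of_continuity :: "(real \<Rightarrow> real) \<Rightarrow> bool" where
  "modulus_of_continuity \<omega> \<longleftrightarrow>
     mono_on {0..} \<omega> \<and> \<omega> 0 = 0 \<and> (\<omega> \<longlongrightarrow> 0) (at_right 0)"

(* Extended-real valued, so that the distance to the empty set is infinite;
   infdist and setdist return 0 there. *)
definition edist_set :: "'a::metric_space \<Rightarrow> 'a set \<Rightarrow> ereal" where
  "edist_set x A = (INF y\<in>A. ereal (dist x y))"

(* A and its complement are never both empty, so the difference is never
   of the form infinity minus infinity. *)
definition signed_dist :: "'a::metric_space \<Rightarrow> 'a set \<Rightarrow> ereal" where
  "signed_dist x A = edist_set x A - edist_set x (- A)"

definition open_sublevel :: "('a \<Rightarrow> real) \<Rightarrow> real \<Rightarrow> 'a set" where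
  "open_sublevel u h = {x. u x < h}"

definition closed_sublevel :: "('a \<Rightarrow> real) \<Rightarrow> real \<Rightarrow> 'a set" where
  "closed_sublevel u h = {x. u x \<le> h}"

(* The sets D_h(s) and E_h(s).  For continuous u and s = 0 they coincide with
   open_sublevel u h and closed_sublevel u h. *)
definition parallel_D :: "('a::metric_space \<Rightarrow> real) \<Rightarrow> real \<Rightarrow> real \<Rightarrow> 'a set" where
  "parallel_D u h s = {x. signed_dist x (open_sublevel u h) < ereal s}"

definition parallel_E :: "('a::metric_space \<Rightarrow> real) \<Rightarrow> real \<Rightarrow> real \<Rightarrow> 'a set" where
  "parallel_E u h s = {x. signed_dist x (closed_sublevel u h) \<le> ereal s}"

definition divergence :: "(real ^ 'n \<Rightarrow> real ^ 'n) \<Rightarrow> real ^ 'n \<Rightarrow> real" where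
  "divergence \<phi> x = trace (jacobian \<phi> (at x))"

definition test_fields :: "(real ^ 'n \<Rightarrow> real ^ 'n) set" where
  "test_fields = {\<phi>.
     (\<exists>\<phi>' :: real ^ 'n \<Rightarrow> ((real ^ 'n) \<Rightarrow>\<^sub>L (real ^ 'n)).
        continuous_on UNIV \<phi>' \<and>
        (\<forall>x. (\<phi> has_derivative blinfun_apply (\<phi>' x)) (at x))) \<and>
     compact (closure {x. \<phi> x \<noteq> 0}) \<and>
     (\<forall>x. norm (\<phi> x) \<le> 1)}"

(* De Giorgi perimeter of a Lebesgue measurable set; it may be infinite. *)
definition perimeter :: "(real ^ 'n) set \<Rightarrow> ereal" where
  "perimeter A = (SUP \<phi>\<in>test_fields. ereal (LINT x:A|lebesgue. divergence \<phi> x))"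

end

theory Submission
  imports Defs
begin

text \<open>Let \<open>d\<close> be the signed distance. Testing the perimeter of \<open>{d < t}\<close> with Lipschitz cutoffs of slope
  \<open>1/\<epsilon>\<close> bounds it, up to a constant, by the lower left derivative at \<open>t\<close> of the volume of \<open>{d < t}\<close>; this is
  the only part of the coarea formula that is needed. The integration by parts
  is done on difference quotients, using only translation invariance of Lebesgue measure, so
  differentiability almost everywhere of Lipschitz functions plays no role. A perimeter of order
  \<open>s powr (-\<sigma>)\<close> therefore gives shells of volume at least of order \<open>s powr (1 - \<sigma>)\<close>, hence of
  \<open>\<mu>\<close>-mass of that order because \<open>\<Theta>\<close> is bounded below on bounded sets, and the positive derivative of
  \<open>f\<close> turns this into the claim with \<open>\<alpha> = 1 - \<sigma>\<close>. If a sublevel set is empty or the whole space,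
  its parallel sets have no perimeter and the hypothesis fails.\<close>

subsection \<open>Integration by parts on difference quotients\<close>

text \<open>The forward quotients of \<open>g\<close> converge to \<open>p\<close> under a common
  integrable bound, and the translation by \<open>h k *\<^sub>R e\<close> moves the shift from
  \<open>g\<close> onto \<open>\<eta>\<close>. Hence \<open>\<eta>\<close> is only required to be
  bounded and Borel.\<close>

lemma tendsto_lborel_integral_difference_quotient:
  fixes g p \<eta> :: "'a::euclidean_space \<Rightarrow> real" and e :: 'a
  assumes deriv: "\<And>x. ((\<lambda>t. g (x + t *\<^sub>R e)) has_real_derivative p x) (at 0)"
    and p: "continuous_on UNIV p"
    and g: "continuous_on UNIV g"
    and supp: "\<And>x. r < norm x \<Longrightarrow> g x = 0"
    and \<eta>: "\<eta> \<in> borel_measurable borel" "\<And>x. \<bar>\<eta> x\<bar> \<le> 1"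
    and h: "h \<longlonglongrightarrow> 0" "\<And>k. 0 < h k" "\<And>k. h k \<le> 1"
  shows "integrable lborel (\<lambda>x. \<eta> x * p x)"
    and "(\<lambda>k. LINT x|lborel. (\<eta> (x - h k *\<^sub>R e) - \<eta> x) / h k * g x)
           \<longlonglongrightarrow> (LINT x|lborel. \<eta> x * p x)"
proof -
  \<comment> \<open>Since \<open>h k \<le> 1\<close>, a point of norm above \<open>R\<close> and its
    shift both lie outside the support of \<open>g\<close>. The extra \<open>norm e\<close> in the
    next ball covers the intermediate points of the mean value theorem.\<close>
  define R where "R = r + norm e"
  have "bounded (p ` cball 0 (R + norm e))"
    by (intro compact_imp_bounded compact_continuous_image compact_cball
        continuous_on_subset[OF p]) auto
  then obtain B where B: "\<And>x. x \<in> cball 0 (R + norm e) \<Longrightarrow> \<bar>p x\<bar> \<le> B"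
    unfolding bounded_iff ball_simps real_norm_def by blast
  define q where "q k x = (g (x + h k *\<^sub>R e) - g x) / h k" for k x
  \<comment> \<open>The hypothesis speaks of parameter 0 on every line; moving the base point along
    the line gives the derivative at every parameter, as the mean value theorem requires.\<close>
  have deriv': "((\<lambda>t. g (x + t *\<^sub>R e)) has_real_derivative p (x + t *\<^sub>R e)) (at t)" for x t
  proof -
    have "((\<lambda>s. g ((x + t *\<^sub>R e) + s *\<^sub>R e)) has_real_derivative p (x + t *\<^sub>R e)) (at (t - t))"
      using deriv[of "x + t *\<^sub>R e"] by simp
    then have "((\<lambda>s. g ((x + t *\<^sub>R e) + (s - t) *\<^sub>R e)) has_real_derivative p (x + t *\<^sub>R e)) (at t)"
      using DERIV_shift[of "\<lambda>s. g ((x + t *\<^sub>R e) + s *\<^sub>R e)" "p (x + t *\<^sub>R e)" t "- t"] by simp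
    then show ?thesis by (simp add: algebra_simps)
  qed
  have hn: "norm (h k *\<^sub>R e) \<le> norm e" for k
    using h(2)[of k] h(3)[of k] by (simp add: mult_left_le_one_le)
  have q_bound: "norm (q k x) \<le> B * indicator (cball 0 R) x" for k x
  proof (cases "norm x \<le> R")
    case True
    obtain z where z: "0 < z" "z < h k"
        "g (x + h k *\<^sub>R e) - g (x + 0 *\<^sub>R e) = (h k - 0) * p (x + z *\<^sub>R e)"
      using MVT2[OF h(2)[of k], of "\<lambda>t. g (x + t *\<^sub>R e)" "\<lambda>t. p (x + t *\<^sub>R e)"] deriv' by auto
    have "q k x = p (x + z *\<^sub>R e)"
      using z h(2)[of k] by (simp add: q_def)
    moreover have "norm (x + z *\<^sub>R e) \<le> R + norm e"
    proof -
      have "norm (z *\<^sub>R e) \<le> norm e"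
        using z h(3)[of k] by (simp add: mult_left_le_one_le)
      then show ?thesis using True norm_triangle_ineq[of x "z *\<^sub>R e"] by linarith
    qed
    ultimately show ?thesis using B[of "x + z *\<^sub>R e"] True by simp
  next
    case False
    have "r < norm x" using False norm_ge_zero[of e] unfolding R_def by linarith
    moreover have "r < norm (x + h k *\<^sub>R e)"
      using False hn[of k] norm_diff_ineq[of x "h k *\<^sub>R e"] unfolding R_def by linarith
    ultimately show ?thesis using False by (simp add: q_def supp)
  qed
  have q_lim: "(\<lambda>k. q k x) \<longlonglongrightarrow> p x" for x
  proof -
    have "((\<lambda>t. (g (x + t *\<^sub>R e) - g x) / t) \<longlongrightarrow> p x) (at 0)"
      using deriv[of x] by (simp add: DERIV_def)
    moreover have "filterlim h (at 0) sequentially"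
      using h(1) less_imp_neq[OF h(2)] by (auto simp: filterlim_at intro!: always_eventually)
    ultimately show ?thesis unfolding q_def by (rule filterlim_compose)
  qed
  have gm[measurable]: "g \<in> borel_measurable borel"
    using g by (rule borel_measurable_continuous_onI)
  have pm[measurable]: "p \<in> borel_measurable borel"
    using p by (rule borel_measurable_continuous_onI)
  note [measurable] = \<eta>(1)
  have w: "integrable lborel (\<lambda>x. B * indicator (cball 0 R) x :: real)"
    by (intro integrable_mult_right integrable_real_indicator) (simp_all add: emeasure_lborel_cball_finite[unfolded infinity_ennreal_def])
  have dom: "AE x in lborel. norm (\<eta> x * q k x) \<le> B * indicator (cball 0 R) x" for k
  proof (rule AE_I2)
    fix x
    have "norm (\<eta> x * q k x) \<le> 1 * norm (q k x)"
      unfolding norm_mult by (intro mult_right_mono) (use \<eta>(2)[of x] in auto)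
    then show "norm (\<eta> x * q k x) \<le> B * indicator (cball 0 R) x"
      using q_bound[of k x] by linarith
  qed
  have lim: "AE x in lborel. (\<lambda>k. \<eta> x * q k x) \<longlonglongrightarrow> \<eta> x * p x"
    by (intro AE_I2 tendsto_mult tendsto_const q_lim)
  have m1: "(\<lambda>x. \<eta> x * p x) \<in> borel_measurable lborel" by measurable
  have m2: "(\<lambda>x. \<eta> x * q k x) \<in> borel_measurable lborel" for k
    unfolding q_def by measurable
  show "integrable lborel (\<lambda>x. \<eta> x * p x)"
    using integrable_dominated_convergence[OF m1 m2 w lim dom] .
  have conv: "(\<lambda>k. LINT x|lborel. \<eta> x * q k x) \<longlonglongrightarrow> (LINT x|lborel. \<eta> x * p x)"
    using integral_dominated_convergence[OF m1 m2 w lim dom] .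
  obtain G where G: "\<And>x. \<bar>g x\<bar> \<le> G"
  proof -
    have "bounded (g ` cball 0 r)"
      by (intro compact_imp_bounded compact_continuous_image compact_cball
          continuous_on_subset[OF g]) auto
    then obtain G where G: "\<And>x. x \<in> cball 0 r \<Longrightarrow> \<bar>g x\<bar> \<le> G"
      unfolding bounded_iff ball_simps real_norm_def by blast
    have "\<bar>g x\<bar> \<le> max G 0" for x
      using G[of x] supp[of x] by (cases "norm x \<le> r") auto
    then show thesis by (rule that)
  qed
  \<comment> \<open>Both halves of the quotient must be integrable separately before the integral
    can be split and one half translated.\<close>
  have int_g: "integrable lborel (\<lambda>x. \<psi> x * g x)"
    if "\<psi> \<in> borel_measurable borel" and \<psi>: "\<And>x. \<bar>\<psi> x\<bar> \<le> 1" for \<psi> :: "'a \<Rightarrow> real"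
  proof (rule Bochner_Integration.integrable_bound)
    show "integrable lborel (\<lambda>x. G * indicator (cball 0 r) x :: real)"
      by (intro integrable_mult_right integrable_real_indicator) (simp_all add: emeasure_lborel_cball_finite[unfolded infinity_ennreal_def])
    show "(\<lambda>x. \<psi> x * g x) \<in> borel_measurable lborel" using that(1) by measurable
    show "AE x in lborel. norm (\<psi> x * g x) \<le> norm (G * indicator (cball 0 r) x :: real)"
    proof (rule AE_I2)
      fix x
      have "norm (\<psi> x * g x) \<le> 1 * \<bar>g x\<bar>"
        unfolding real_norm_def abs_mult using \<psi>[of x] by (intro mult_right_mono) auto
      also have "\<dots> \<le> norm (G * indicator (cball 0 r) x :: real)"
        using G[of x] supp[of x] by (auto simp: indicator_def)
      finally show "norm (\<psi> x * g x) \<le> norm (G * indicator (cball 0 r) x :: real)" .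
    qed
  qed
  have eq: "(LINT x|lborel. \<eta> x * q k x) = (LINT x|lborel. (\<eta> (x - h k *\<^sub>R e) - \<eta> x) / h k * g x)" for k
  proof -
    define c where "c = h k *\<^sub>R e"
    have distr: "distr lborel borel ((+) (- c)) = (lborel :: 'a measure)"
      by (rule lborel_distr_plus)
    have i1: "integrable lborel (\<lambda>x. \<eta> (x - c) * g x)"
      by (rule int_g) (use \<eta>(2) in auto)
    have i0: "integrable lborel (\<lambda>x. \<eta> x * g x)"
      by (rule int_g) (use \<eta> in auto)
    have F: "(\<lambda>x. \<eta> x * g (x + c)) \<in> borel_measurable borel" by measurable
    have "(LINT x|lborel. \<eta> x * g (x + c)) = (LINT x|distr lborel borel ((+) (- c)). \<eta> x * g (x + c))"
      by (simp only: distr)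
    also have "\<dots> = (LINT x|lborel. \<eta> (x - c) * g x)"
      using F by (subst integral_distr) simp_all
    finally have s: "(LINT x|lborel. \<eta> x * g (x + c)) = (LINT x|lborel. \<eta> (x - c) * g x)" .
    have i2: "integrable lborel (\<lambda>x. \<eta> x * g (x + c))"
    proof -
      have "integrable (distr lborel borel ((+) (- c))) (\<lambda>x. \<eta> x * g (x + c))"
        using F i1 by (subst integrable_distr_eq) simp_all
      then show ?thesis by (simp only: distr)
    qed
    have "(LINT x|lborel. \<eta> x * q k x) = (LINT x|lborel. (\<eta> x * g (x + c) - \<eta> x * g x) / h k)"
      unfolding q_def c_def by (simp add: algebra_simps)
    also have "\<dots> = ((LINT x|lborel. \<eta> (x - c) * g x) - (LINT x|lborel. \<eta> x * g x)) / h k"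
      using i0 i2 s by simp
    also have "\<dots> = (LINT x|lborel. (\<eta> (x - c) * g x - \<eta> x * g x) / h k)"
      using i0 i1 by simp
    also have "\<dots> = (LINT x|lborel. (\<eta> (x - c) - \<eta> x) / h k * g x)"
      by (simp add: algebra_simps diff_divide_distrib)
    finally show ?thesis by (simp add: c_def)
  qed
  show "(\<lambda>k. LINT x|lborel. (\<eta> (x - h k *\<^sub>R e) - \<eta> x) / h k * g x)
           \<longlonglongrightarrow> (LINT x|lborel. \<eta> x * p x)"
    using conv unfolding eq .
qed

text \<open>Only the diagonal partial derivatives enter the trace of the Jacobian, so a test field
  is reduced to one-variable derivatives of its components along the axes, with continuous values
  and bounded support.\<close>

lemma test_fieldE:
  fixes \<phi> :: "real ^ 'n \<Rightarrow> real ^ 'n"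
  assumes "\<phi> \<in> test_fields"
  obtains r p where
    "\<And>i x. ((\<lambda>t. \<phi> (x + t *\<^sub>R axis i 1) $ i) has_real_derivative p i x) (at 0)"
    "\<And>i. continuous_on UNIV (p i)"
    "\<And>x. r < norm x \<Longrightarrow> \<phi> x = 0"
    "continuous_on UNIV \<phi>"
    "\<And>x. divergence \<phi> x = (\<Sum>i\<in>UNIV. p i x)"
proof -
  obtain \<phi>' :: "real ^ 'n \<Rightarrow> ((real ^ 'n) \<Rightarrow>\<^sub>L (real ^ 'n))" where \<phi>':
      "continuous_on UNIV \<phi>'" "\<And>x. (\<phi> has_derivative blinfun_apply (\<phi>' x)) (at x)"
    and comp: "compact (closure {x. \<phi> x \<noteq> 0})"
    using assms unfolding test_fields_def by blast
  define p where "p i x = blinfun_apply (\<phi>' x) (axis i 1) $ i" for i x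
  obtain r where r: "\<And>x. x \<in> closure {x. \<phi> x \<noteq> 0} \<Longrightarrow> norm x \<le> r"
    using compact_imp_bounded[OF comp] unfolding bounded_iff by blast
  show thesis
  proof
    show "((\<lambda>t. \<phi> (x + t *\<^sub>R axis i 1) $ i) has_real_derivative p i x) (at 0)" for i x
    proof -
      have l: "((\<lambda>t::real. x + t *\<^sub>R axis i 1) has_derivative (\<lambda>t. t *\<^sub>R axis i 1)) (at 0)"
        by (auto intro!: derivative_eq_intros)
      have "(\<phi> has_derivative blinfun_apply (\<phi>' x)) (at (x + 0 *\<^sub>R axis i 1))"
        using \<phi>'(2) by simp
      from has_derivative_compose[OF l this]
      have "((\<lambda>t. \<phi> (x + t *\<^sub>R axis i 1)) has_derivative (\<lambda>t. blinfun_apply (\<phi>' x) (t *\<^sub>R axis i 1))) (at 0)" .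
      from bounded_linear.has_derivative[OF bounded_linear_vec_nth this]
      have "((\<lambda>t. \<phi> (x + t *\<^sub>R axis i 1) $ i) has_derivative (\<lambda>t. blinfun_apply (\<phi>' x) (t *\<^sub>R axis i 1) $ i)) (at 0)" .
      then show ?thesis
        by (simp add: has_field_derivative_def p_def blinfun.scaleR_right mult_commute_abs)
    qed
    show "continuous_on UNIV (p i)" for i
      unfolding p_def by (intro continuous_intros \<phi>'(1))
    show "\<phi> x = 0" if "r < norm x" for x
      using r[of x] that closure_subset[of "{x. \<phi> x \<noteq> 0}"] by force
    show "continuous_on UNIV \<phi>"
      using \<phi>'(2) has_derivative_continuous continuous_at_imp_continuous_on by blast
    show "divergence \<phi> x = (\<Sum>i\<in>UNIV. p i x)" for x
      using frechet_derivative_at[OF \<phi>'(2)[of x]]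
      by (simp add: divergence_def trace_def jacobian_def matrix_def p_def)
  qed
qed

text \<open>Integration by parts coordinate by coordinate: every quotient integral is at most
  \<open>B\<close>, so is its limit as \<open>h\<close> tends to 0, and the sum over the coordinates
  gives the factor \<open>CARD('n)\<close>.\<close>

lemma integral_divergence_le:
  fixes \<phi> :: "real ^ 'n \<Rightarrow> real ^ 'n" and \<eta> :: "real ^ 'n \<Rightarrow> real"
  assumes \<phi>: "\<phi> \<in> test_fields"
    and \<eta>: "\<eta> \<in> borel_measurable borel" "\<And>x. \<bar>\<eta> x\<bar> \<le> 1"
    and "0 < \<delta>"
    and le: "\<And>i h. 0 < h \<Longrightarrow> h < \<delta> \<Longrightarrow>
      (LINT x|lborel. (\<eta> (x - h *\<^sub>R axis i 1) - \<eta> x) / h * \<phi> x $ i) \<le> B"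
  shows "integrable lborel (\<lambda>x. \<eta> x * divergence \<phi> x)"
    and "(LINT x|lborel. \<eta> x * divergence \<phi> x) \<le> real CARD('n) * B"
proof -
  obtain r p where p: "\<And>i x. ((\<lambda>t. \<phi> (x + t *\<^sub>R axis i 1) $ i) has_real_derivative p i x) (at 0)"
    "\<And>i. continuous_on UNIV (p i)" "\<And>x. r < norm x \<Longrightarrow> \<phi> x = 0" "continuous_on UNIV \<phi>"
    "\<And>x. divergence \<phi> x = (\<Sum>i\<in>UNIV. p i x)"
    using test_fieldE[OF \<phi>] by metis
  \<comment> \<open>A concrete null sequence in (0,1] that stays below \<open>\<delta>\<close>, so
    that both the limit lemma and the hypothesis \<open>le\<close> apply to all its terms.\<close>
  define h where "h k = min 1 (\<delta> / 2) * inverse (real (Suc k))" for k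
  have h: "h \<longlonglongrightarrow> 0" "0 < h k" "h k \<le> 1" "h k < \<delta>" for k
  proof -
    show "h \<longlonglongrightarrow> 0"
      unfolding h_def by (intro tendsto_mult_right_zero LIMSEQ_inverse_real_of_nat)
    show "0 < h k" using \<open>0 < \<delta>\<close> by (simp add: h_def)
    have "h k \<le> min 1 (\<delta> / 2) * 1"
      unfolding h_def by (intro mult_left_mono) (use \<open>0 < \<delta>\<close> in \<open>auto simp: field_simps\<close>)
    then show "h k \<le> 1" "h k < \<delta>" using \<open>0 < \<delta>\<close> by auto
  qed
  have cont: "continuous_on UNIV (\<lambda>x. \<phi> x $ i)" for i
    by (intro continuous_intros p(4))
  have supp: "r < norm x \<Longrightarrow> \<phi> x $ i = 0" for x i
    using p(3) by simp
  have dq: "integrable lborel (\<lambda>x. \<eta> x * p i x)"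
    "(\<lambda>k. LINT x|lborel. (\<eta> (x - h k *\<^sub>R axis i 1) - \<eta> x) / h k * \<phi> x $ i)
       \<longlonglongrightarrow> (LINT x|lborel. \<eta> x * p i x)" for i
    using tendsto_lborel_integral_difference_quotient[OF p(1,2) cont supp \<eta> h(1-3)] by simp_all
  have "(LINT x|lborel. \<eta> x * p i x) \<le> B" for i
    using dq(2)[of i] by (rule LIMSEQ_le_const2) (use le h in auto)
  then have "(\<Sum>i\<in>UNIV. LINT x|lborel. \<eta> x * p i x) \<le> real CARD('n) * B"
    using sum_bounded_above[of UNIV "\<lambda>i::'n. LINT x|lborel. \<eta> x * p i x" B] by simp
  moreover have eq: "(\<lambda>x. \<eta> x * divergence \<phi> x) = (\<lambda>x. \<Sum>i\<in>UNIV. \<eta> x * p i x)"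
    by (simp add: p(5) sum_distrib_left)
  ultimately show "(LINT x|lborel. \<eta> x * divergence \<phi> x) \<le> real CARD('n) * B"
    using dq(1) by simp
  show "integrable lborel (\<lambda>x. \<eta> x * divergence \<phi> x)"
    unfolding eq using dq(1) by simp
qed

section \<open>Integrals of divergences and the perimeter of complements\<close>

lemma integrable_divergence:
  assumes "\<phi> \<in> test_fields"
  shows "integrable lborel (divergence \<phi>)"
  using integral_divergence_le(1)[OF assms, of "\<lambda>_. 1" 1 0] by simp

text \<open>For the constant weight 1 every difference quotient vanishes, so \<open>B = 0\<close> is
  admissible.\<close>

lemma integral_divergence_nonpos:
  assumes "\<phi> \<in> test_fields"
  shows "(LINT x|lborel. divergence \<phi> x) \<le> 0"
  using integral_divergence_le(2)[OF assms, of "\<lambda>_. 1" 1 0] by simp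

text \<open>The perimeter is defined by Lebesgue integrals, while translation invariance is used for
  \<open>lborel\<close>; on Borel integrands the completion changes nothing.\<close>

lemma set_integral_lebesgue_divergence:
  fixes A :: "(real ^ 'n) set"
  assumes "\<phi> \<in> test_fields" "A \<in> sets borel"
  shows "(LINT x:A|lebesgue. divergence \<phi> x) = (LINT x|lborel. indicator A x * divergence \<phi> x)"
proof -
  have [measurable]: "divergence \<phi> \<in> borel_measurable borel"
    using borel_measurable_integrable[OF integrable_divergence[OF assms(1)]] by simp
  have "(\<lambda>x. indicator A x * divergence \<phi> x) \<in> borel_measurable lborel"
    using assms(2) by measurable
  then show ?thesis
    unfolding set_lebesgue_integral_def by (simp add: integral_completion)
qed

lemma uminus_test_fields:
  fixes \<phi> :: "real ^ 'n \<Rightarrow> real ^ 'n"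
  assumes "\<phi> \<in> test_fields"
  shows "(\<lambda>x. - \<phi> x) \<in> test_fields" and "divergence (\<lambda>x. - \<phi> x) = (\<lambda>x. - divergence \<phi> x)"
proof -
  obtain \<phi>' :: "real ^ 'n \<Rightarrow> ((real ^ 'n) \<Rightarrow>\<^sub>L (real ^ 'n))" where \<phi>':
      "continuous_on UNIV \<phi>'" "\<And>x. (\<phi> has_derivative blinfun_apply (\<phi>' x)) (at x)"
    and comp: "compact (closure {x. \<phi> x \<noteq> 0})" and norm1: "\<And>x. norm (\<phi> x) \<le> 1"
    using assms unfolding test_fields_def by blast
  have d: "((\<lambda>x. - \<phi> x) has_derivative blinfun_apply (- \<phi>' x)) (at x)" for x
    using has_derivative_minus[OF \<phi>'(2)] by (simp add: uminus_blinfun.rep_eq)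
  have "continuous_on UNIV (\<lambda>x. - \<phi>' x)"
    by (intro continuous_intros \<phi>'(1))
  with d comp norm1 show "(\<lambda>x. - \<phi> x) \<in> test_fields"
    unfolding test_fields_def by (intro CollectI conjI exI[of _ "\<lambda>x. - \<phi>' x"]) auto
  show "divergence (\<lambda>x. - \<phi> x) = (\<lambda>x. - divergence \<phi> x)"
  proof
    fix x
    have "frechet_derivative (\<lambda>x. - \<phi> x) (at x) = (\<lambda>v. - blinfun_apply (\<phi>' x) v)"
      using frechet_derivative_at[OF has_derivative_minus[OF \<phi>'(2)]] by simp
    moreover have "frechet_derivative \<phi> (at x) = blinfun_apply (\<phi>' x)"
      using frechet_derivative_at[OF \<phi>'(2)] by simp
    ultimately show "divergence (\<lambda>x. - \<phi> x) x = - divergence \<phi> x"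
      by (simp add: divergence_def trace_def jacobian_def matrix_def sum_negf)
  qed
qed

text \<open>The class of test fields is symmetric, so the upper bound 0 for the negated field is the
  lower bound for the field itself.\<close>

lemma integral_divergence_eq_0:
  assumes "\<phi> \<in> test_fields"
  shows "(LINT x|lborel. divergence \<phi> x) = 0"
  using integral_divergence_nonpos[OF assms]
    integral_divergence_nonpos[OF uminus_test_fields(1)[OF assms]]
  by (simp add: uminus_test_fields(2)[OF assms])

text \<open>A divergence has total integral zero, so its integral over \<open>A\<close> equals that
  of the negated field over the complement, and the negated field competes in the supremum for
  \<open>- A\<close>.\<close>

lemma perimeter_Compl_le:
  fixes A :: "(real ^ 'n) set"
  assumes "A \<in> sets borel"
  shows "perimeter A \<le> perimeter (- A)"
  unfolding perimeter_def
proof (rule SUP_least)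
  fix \<phi> :: "real ^ 'n \<Rightarrow> real ^ 'n" assume \<phi>: "\<phi> \<in> test_fields"
  have i: "integrable lborel (\<lambda>x. indicator A x * divergence \<phi> x)"
    using integrable_mult_indicator[of A lborel "divergence \<phi>"] integrable_divergence[OF \<phi>] assms by simp
  have cA: "- A \<in> sets borel" using assms by auto
  have "(LINT x:A|lebesgue. divergence \<phi> x) = (LINT x|lborel. indicator A x * divergence \<phi> x)"
    by (rule set_integral_lebesgue_divergence[OF \<phi> assms])
  also have "\<dots> = (LINT x|lborel. indicator A x * divergence \<phi> x - divergence \<phi> x)"
    using i integrable_divergence[OF \<phi>] integral_divergence_eq_0[OF \<phi>] by simp
  also have "\<dots> = (LINT x|lborel. indicator (- A) x * divergence (\<lambda>x. - \<phi> x) x)"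
    unfolding uminus_test_fields(2)[OF \<phi>]
    by (intro Bochner_Integration.integral_cong) (auto simp: indicator_def)
  also have "\<dots> = (LINT x:-A|lebesgue. divergence (\<lambda>x. - \<phi> x) x)"
    by (rule set_integral_lebesgue_divergence[OF uminus_test_fields(1)[OF \<phi>] cA, symmetric])
  finally show "ereal (LINT x:A|lebesgue. divergence \<phi> x)
      \<le> (SUP \<phi>\<in>test_fields. ereal (LINT x:-A|lebesgue. divergence \<phi> x))"
    using uminus_test_fields(1)[OF \<phi>] by (intro SUP_upper2[of "\<lambda>x. - \<phi> x"]) simp_all
qed

lemma perimeter_empty_le: "perimeter ({} :: (real ^ 'n) set) \<le> 0"
  unfolding perimeter_def by (intro SUP_least) (simp add: set_lebesgue_integral_def)

lemma perimeter_UNIV_le: "perimeter (UNIV :: (real ^ 'n) set) \<le> 0"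
  using order_trans[OF perimeter_Compl_le[of "UNIV :: (real ^ 'n) set"]] perimeter_empty_le by simp

subsection \<open>Perimeter and volume of shells\<close>

text \<open>Monotonicity replaces the usual one-sided continuity hypothesis: at the infimum \<open>c\<close> of the points
  where the inequality holds, \<open>F c\<close> is at most the right limit of \<open>F\<close>.\<close>

lemma left_Dini_mono:
  fixes F :: "real \<Rightarrow> real"
  assumes "a \<le> b"
    and mono: "\<And>x y. a \<le> x \<Longrightarrow> x \<le> y \<Longrightarrow> y \<le> b \<Longrightarrow> F x \<le> F y"
    and dini: "\<And>t. a < t \<Longrightarrow> t \<le> b \<Longrightarrow>
      \<exists>\<delta>>0. \<forall>\<epsilon>. 0 < \<epsilon> \<and> \<epsilon> < \<delta> \<and> a \<le> t - \<epsilon> \<longrightarrow> K * \<epsilon> \<le> F t - F (t - \<epsilon>)"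
  shows "K * (b - a) \<le> F b - F a"
proof -
  define S where "S = {t \<in> {a..b}. K * (b - t) \<le> F b - F t}"
  define c where "c = Inf S"
  have bS: "b \<in> S" using assms(1) by (simp add: S_def)
  have bdd: "bdd_below S" by (auto simp: S_def bdd_below_def)
  have cb: "a \<le> c" "c \<le> b"
    using bS bdd by (auto simp: c_def S_def intro!: cInf_greatest cInf_lower)
  have cS: "c \<in> S"
  proof -
    have "K * (b - c) \<le> F b - F c"
    proof (rule field_le_epsilon)
      fix e :: real assume "0 < e"
      \<comment> \<open>This choice gives \<open>K * (t - c) \<le> e\<close> whatever the sign of
        \<open>K\<close>; adding 1 avoids a zero denominator.\<close>
      define d where "d = e / (\<bar>K\<bar> + 1)"
      have "0 < d" using \<open>0 < e\<close> by (simp add: d_def)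
      then obtain t where t: "t \<in> S" "t < c + d"
        using cInf_lessD[of S "c + d"] bS by (auto simp: c_def)
      have ct: "c \<le> t" using t(1) bdd by (simp add: c_def cInf_lower)
      have "F c \<le> F t" using t(1) ct cb by (intro mono) (auto simp: S_def)
      moreover have "K * (t - c) \<le> e"
      proof -
        have "K * (t - c) \<le> (\<bar>K\<bar> + 1) * d"
          using t(2) ct \<open>0 < d\<close> by (intro mult_mono) auto
        then show ?thesis by (simp add: d_def)
      qed
      moreover have "K * (b - t) \<le> F b - F t" using t(1) by (simp add: S_def)
      ultimately show "K * (b - c) \<le> F b - F c + e" by (simp add: algebra_simps)
    qed
    then show ?thesis using cb by (simp add: S_def)
  qed
  have "c = a"
  proof (rule ccontr)
    assume "c \<noteq> a"
    then have "a < c" using cb by simp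
    obtain \<delta> where \<delta>: "\<delta> > 0"
      "\<And>\<epsilon>. 0 < \<epsilon> \<Longrightarrow> \<epsilon> < \<delta> \<Longrightarrow> a \<le> c - \<epsilon> \<Longrightarrow> K * \<epsilon> \<le> F c - F (c - \<epsilon>)"
      using dini[OF \<open>a < c\<close> cb(2)] by blast
    \<comment> \<open>Cutting the step at \<open>c - a\<close> keeps \<open>c - \<epsilon>\<close>
      in the interval; the gain there adds to the inequality at \<open>c\<close> and puts a point of
      \<open>S\<close> below its infimum.\<close>
    define \<epsilon> where "\<epsilon> = min (\<delta> / 2) (c - a)"
    have \<epsilon>: "0 < \<epsilon>" "\<epsilon> < \<delta>" "a \<le> c - \<epsilon>"
      using \<delta>(1) \<open>a < c\<close> by (auto simp: \<epsilon>_def)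
    have "c - \<epsilon> \<in> S"
      using \<delta>(2)[OF \<epsilon>] cS \<epsilon> cb by (auto simp: S_def algebra_simps)
    then have "c \<le> c - \<epsilon>" unfolding c_def using bdd by (rule cInf_lower)
    then show False using \<epsilon>(1) by simp
  qed
  then show ?thesis using cS by (simp add: S_def)
qed

lemma borel_measurable_lipschitz:
  fixes d :: "'a::euclidean_space \<Rightarrow> real"
  assumes lip: "\<And>x y. \<bar>d x - d y\<bar> \<le> L * dist x y" and "0 < L"
  shows "d \<in> borel_measurable borel"
proof (rule borel_measurable_continuous_onI)
  show "continuous_on UNIV d"
    unfolding continuous_on_iff
  proof (intro ballI allI impI)
    fix x e assume "0 < (e::real)"
    then show "\<exists>\<delta>>0. \<forall>x'\<in>UNIV. dist x' x < \<delta> \<longrightarrow> dist (d x') (d x) < e"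
      using lip \<open>0 < L\<close>
      by (intro exI[of _ "e / L"])
        (auto simp: dist_real_def field_simps intro: le_less_trans)
  qed
qed

text \<open>Some test field gives more than \<open>K\<close> on the sublevel set, and still does
  after the indicator is replaced by a cutoff of slope \<open>1 / \<epsilon>\<close> in
  \<open>d\<close>. Each difference quotient of the cutoff, times a component of the field, is at
  most \<open>L / \<epsilon>\<close> on the shell and zero off it, so integration by parts bounds
  the result by the volume of the shell.\<close>

lemma perimeter_sublevel_shell:
  fixes d :: "real ^ 'n \<Rightarrow> real"
  assumes lip: "\<And>x y. \<bar>d x - d y\<bar> \<le> L * dist x y"
    and "0 < L"
    and K: "ereal K < perimeter {x. d x < t}"
    and bdd: "bounded {x. a \<le> d x \<and> d x < t}" and "a < t"
  shows "\<exists>\<delta>>0. \<forall>\<epsilon>. 0 < \<epsilon> \<and> \<epsilon> < \<delta> \<longrightarrow>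
    K * \<epsilon> \<le> real CARD('n) * L * measure lborel {x. t - 3 * \<epsilon> \<le> d x \<and> d x < t}"
proof -
  have [measurable]: "d \<in> borel_measurable borel"
    using lip \<open>0 < L\<close> by (rule borel_measurable_lipschitz)
  obtain \<phi> :: "real ^ 'n \<Rightarrow> real ^ 'n" where \<phi>: "\<phi> \<in> test_fields"
    and K\<phi>: "K < (LINT x:{x. d x < t}|lebesgue. divergence \<phi> x)"
    using K unfolding perimeter_def less_SUP_iff by auto
  have Kl: "K < (LINT x|lborel. indicator {x. d x < t} x * divergence \<phi> x)"
    using K\<phi> by (subst (asm) set_integral_lebesgue_divergence[OF \<phi>]) measurable
  \<comment> \<open>The layers where the cutoff varies stay at distance \<open>\<epsilon>\<close> inside the shell, so that translates
    of the cutoff by less than \<open>\<epsilon> / L\<close> still differ from it only on the shell.\<close>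
  define \<eta> where "\<eta> \<epsilon> x = max 0 (min 1 ((t - \<epsilon> - d x) / \<epsilon>))" for \<epsilon> x
  have \<eta>_meas[measurable]: "\<eta> \<epsilon> \<in> borel_measurable borel" for \<epsilon>
    unfolding \<eta>_def by measurable
  have \<eta>_le: "\<bar>\<eta> \<epsilon> x\<bar> \<le> 1" for \<epsilon> x
    by (auto simp: \<eta>_def)
  have \<eta>_lim: "((\<lambda>\<epsilon>. \<eta> \<epsilon> x) \<longlongrightarrow> indicator {x. d x < t} x) (at_right 0)" for x
  proof (cases "d x < t")
    case True
    have "\<forall>\<^sub>F \<epsilon> in at_right 0. 0 < \<epsilon> \<and> \<epsilon> < (t - d x) / 2"
      using True by (auto simp: eventually_at_right_field intro!: exI[of _ "(t - d x) / 2"])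
    then have "\<forall>\<^sub>F \<epsilon> in at_right 0. \<eta> \<epsilon> x = 1"
      by eventually_elim (auto simp: \<eta>_def field_simps max_def min_def)
    then show ?thesis using True by (simp add: tendsto_eventually)
  next
    case False
    have "\<forall>\<^sub>F \<epsilon> in at_right 0. (0::real) < \<epsilon>"
      by (simp add: eventually_at_right_less)
    then have "\<forall>\<^sub>F \<epsilon> in at_right 0. \<eta> \<epsilon> x = 0"
    proof eventually_elim
      case (elim \<epsilon>)
      then have "(t - \<epsilon> - d x) / \<epsilon> \<le> 0" using False by (intro divide_nonpos_pos) auto
      then show ?case by (simp add: \<eta>_def)
    qed
    then show ?thesis using False by (simp add: tendsto_eventually)
  qed
  have div_int: "integrable lborel (divergence \<phi>)"
    by (rule integrable_divergence[OF \<phi>])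
  have div_meas[measurable]: "divergence \<phi> \<in> borel_measurable borel"
    using borel_measurable_integrable[OF div_int] by simp
  \<comment> \<open>The substitution of \<open>inverse T\<close> for \<open>\<epsilon>\<close> turns
    the limit at 0 from the right into one at infinity, where dominated convergence is available for
    a real parameter.\<close>
  have "((\<lambda>\<epsilon>. LINT x|lborel. \<eta> \<epsilon> x * divergence \<phi> x)
      \<longlongrightarrow> (LINT x|lborel. indicator {x. d x < t} x * divergence \<phi> x)) (at_right 0)"
    unfolding filterlim_at_right_to_top
  proof (rule integral_dominated_convergence_at_top)
    show "\<forall>\<^sub>F T in at_top. AE x in lborel. norm (\<eta> (inverse T) x * divergence \<phi> x) \<le> norm (divergence \<phi> x)"
      using \<eta>_le by (auto simp: abs_mult intro!: always_eventually mult_left_le_one_le)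
    show "AE x in lborel. ((\<lambda>T. \<eta> (inverse T) x * divergence \<phi> x)
        \<longlongrightarrow> indicator {x. d x < t} x * divergence \<phi> x) at_top"
      using \<eta>_lim unfolding filterlim_at_right_to_top by (intro AE_I2 tendsto_mult tendsto_const)
  qed (use div_int in \<open>auto intro!: integrable_norm\<close>)
  then have "\<forall>\<^sub>F \<epsilon> in at_right 0. K < (LINT x|lborel. \<eta> \<epsilon> x * divergence \<phi> x)"
    using Kl by (rule order_tendstoD)
  then obtain \<delta> where \<delta>: "0 < \<delta>" "\<And>\<epsilon>. 0 < \<epsilon> \<Longrightarrow> \<epsilon> < \<delta> \<Longrightarrow> K < (LINT x|lborel. \<eta> \<epsilon> x * divergence \<phi> x)"
    unfolding eventually_at_right_field by auto
  have norm1: "\<bar>\<phi> x $ i\<bar> \<le> 1" for x i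
    using \<phi> component_le_norm_cart[of "\<phi> x" i] unfolding test_fields_def by (auto intro: order_trans)
  have main: "K * \<epsilon> \<le> real CARD('n) * L * measure lborel {x. t - 3 * \<epsilon> \<le> d x \<and> d x < t}"
    if \<epsilon>: "0 < \<epsilon>" "\<epsilon> < \<delta>" "\<epsilon> < (t - a) / 3" for \<epsilon>
  proof -
    define S where "S = {x. t - 3 * \<epsilon> \<le> d x \<and> d x < t}"
    have S_meas[measurable]: "S \<in> sets borel" unfolding S_def by measurable
    have "bounded S"
      using bdd by (rule bounded_subset) (use \<epsilon> in \<open>auto simp: S_def\<close>)
    then have S_int: "integrable lborel (\<lambda>x. L / \<epsilon> * indicator S x :: real)"
      by (intro integrable_mult_right integrable_real_indicator) (simp_all add: emeasure_bounded_finite[unfolded infinity_ennreal_def])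
    have pt: "(\<eta> \<epsilon> (x - h *\<^sub>R axis i 1) - \<eta> \<epsilon> x) / h * \<phi> x $ i \<le> L / \<epsilon> * indicator S x"
      if h: "0 < h" "h < \<epsilon> / L" for h :: real and x i
    proof -
      define y where "y = x - h *\<^sub>R axis i (1::real)"
      have "dist y x = h" using h by (simp add: y_def dist_norm)
      then have dyx: "\<bar>d y - d x\<bar> \<le> L * h" using lip[of y x] by simp
      have Lh: "L * h < \<epsilon>" using h \<open>0 < L\<close> by (simp add: field_simps)
      show ?thesis
      proof (cases "x \<in> S")
        case True
        \<comment> \<open>Clamping to [0,1] does not increase distances.\<close>
        have "\<bar>\<eta> \<epsilon> y - \<eta> \<epsilon> x\<bar> \<le> \<bar>(t - \<epsilon> - d y) / \<epsilon> - (t - \<epsilon> - d x) / \<epsilon>\<bar>"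
          unfolding \<eta>_def by linarith
        also have "\<dots> = \<bar>d y - d x\<bar> / \<epsilon>"
          using \<epsilon>(1) by (simp add: abs_minus_commute flip: diff_divide_distrib)
        also have "\<dots> \<le> L * h / \<epsilon>"
          using dyx \<epsilon>(1) by (simp add: divide_right_mono)
        finally have "\<bar>(\<eta> \<epsilon> y - \<eta> \<epsilon> x) / h\<bar> \<le> L / \<epsilon>"
          using h by (simp add: field_simps)
        then have "\<bar>(\<eta> \<epsilon> y - \<eta> \<epsilon> x) / h * \<phi> x $ i\<bar> \<le> L / \<epsilon> * 1"
          unfolding abs_mult by (intro mult_mono norm1) (use \<open>0 < L\<close> \<epsilon>(1) in auto)
        then have "(\<eta> \<epsilon> y - \<eta> \<epsilon> x) / h * \<phi> x $ i \<le> L / \<epsilon>" by (simp only: abs_le_iff mult_1_right)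
        then show ?thesis using True by (simp add: y_def)
      next
        case False
        have "\<eta> \<epsilon> y = \<eta> \<epsilon> x"
        proof (cases "d x < t")
          case True
          then have "d x < t - 3 * \<epsilon>" using False by (auto simp: S_def)
          then have "1 \<le> (t - \<epsilon> - d x) / \<epsilon>" "1 \<le> (t - \<epsilon> - d y) / \<epsilon>"
            using \<epsilon>(1) dyx Lh by (auto simp: le_divide_eq)
          then show ?thesis by (simp add: \<eta>_def)
        next
          case False
          then have "(t - \<epsilon> - d x) / \<epsilon> \<le> 0" "(t - \<epsilon> - d y) / \<epsilon> \<le> 0"
            using \<epsilon>(1) dyx Lh by (auto simp: divide_le_0_iff)
          then show ?thesis by (simp add: \<eta>_def)
        qed
        then show ?thesis using False by (simp add: y_def)
      qed
    qed
    have le: "(LINT x|lborel. (\<eta> \<epsilon> (x - h *\<^sub>R axis i 1) - \<eta> \<epsilon> x) / h * \<phi> x $ i)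
        \<le> L / \<epsilon> * measure lborel S" if h: "0 < h" "h < \<epsilon> / L" for h :: real and i
    proof -
      have "(LINT x|lborel. (\<eta> \<epsilon> (x - h *\<^sub>R axis i 1) - \<eta> \<epsilon> x) / h * \<phi> x $ i)
          \<le> (LINT x|lborel. L / \<epsilon> * indicator S x)"
        by (rule integral_mono'[OF S_int pt[OF h]])
          (use \<open>0 < L\<close> \<epsilon>(1) in auto)
      then show ?thesis by simp
    qed
    have "(LINT x|lborel. \<eta> \<epsilon> x * divergence \<phi> x) \<le> real CARD('n) * (L / \<epsilon> * measure lborel S)"
      by (rule integral_divergence_le(2)[OF \<phi> \<eta>_meas \<eta>_le _ le, of "\<epsilon> / L"])
        (use \<open>0 < L\<close> \<epsilon>(1) in auto)
    then have "K \<le> real CARD('n) * (L / \<epsilon> * measure lborel S)"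
      using \<delta>(2)[OF \<epsilon>(1,2)] by linarith
    then show ?thesis using \<epsilon>(1) by (simp add: S_def field_simps)
  qed
  \<comment> \<open>The bound \<open>(t - a) / 3\<close> keeps \<open>t - 3 * \<epsilon>\<close>
    above \<open>a\<close>, so the shell lies in the set assumed bounded and has finite
    volume.\<close>
  show ?thesis
    using main \<open>0 < \<delta>\<close> \<open>a < t\<close> by (intro exI[of _ "min \<delta> ((t - a) / 3)"]) auto
qed

text \<open>On \<open>{-s..-s/2}\<close> the perimeter exceeds the constant \<open>C / s powr \<sigma>\<close>, which is all that the order
  \<open>1 - \<sigma>\<close> of the bound requires.\<close>

lemma perimeter_shell_measure:
  fixes d :: "real ^ 'n \<Rightarrow> real"
  assumes lip: "\<And>x y. \<bar>d x - d y\<bar> \<le> L * dist x y"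
    and L: "0 < L"
    and C: "0 < C" and s: "0 < s" and \<sigma>: "0 < \<sigma>"
    and per: "\<And>t. - s \<le> t \<Longrightarrow> t < 0 \<Longrightarrow> ereal (C / (- t) powr \<sigma>) \<le> perimeter {x. d x < t}"
    and bdd: "bounded {x. - s \<le> d x \<and> d x < 0}"
  shows "C / (12 * real CARD('n) * L) * s powr (1 - \<sigma>) \<le> measure lborel {x. - s \<le> d x \<and> d x < 0}"
proof -
  have [measurable]: "d \<in> borel_measurable borel"
    using lip \<open>0 < L\<close> by (rule borel_measurable_lipschitz)
  define F where "F t = measure lborel {x. - s \<le> d x \<and> d x < t}" for t
  \<comment> \<open>Half of the lower bound for the perimeter, because the shell estimate asks for a
    strict inequality.\<close>
  define K where "K = C / s powr \<sigma> / 2"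
  define n where "n = real CARD('n)"
  have n: "0 < n" by (simp add: n_def)
  have fin: "{x. a \<le> d x \<and> d x < t} \<in> fmeasurable lborel" if "- s \<le> a" "t \<le> 0" for a t
  proof -
    have "bounded {x. a \<le> d x \<and> d x < t}"
      using bdd by (rule bounded_subset) (use that in auto)
    then show ?thesis
      by (intro fmeasurableI) (simp_all add: emeasure_bounded_finite[unfolded infinity_ennreal_def])
  qed
  have mono: "F x \<le> F y" if "x \<le> y" "y \<le> 0" for x y
    unfolding F_def by (rule measure_mono_fmeasurable) (use that fin in \<open>auto intro!: fmeasurableD\<close>)
  have "K / (3 * n * L) * (- (s / 2) - (- s)) \<le> F (- (s / 2)) - F (- s)"
  proof (rule left_Dini_mono)
    fix t assume t: "- s < t" "t \<le> - (s / 2)"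
    have "ereal K < ereal (C / (- t) powr \<sigma>)"
    proof -
      have "K < C / s powr \<sigma>" using divide_pos_pos[OF C, of "s powr \<sigma>"] s unfolding K_def by simp
      also have "\<dots> \<le> C / (- t) powr \<sigma>"
        using C s t \<sigma> by (intro divide_left_mono powr_mono2 mult_pos_pos) auto
      finally show ?thesis by simp
    qed
    also have "\<dots> \<le> perimeter {x. d x < t}"
      using per t s by simp
    finally have K: "ereal K < perimeter {x. d x < t}" .
    have "bounded {x. - s \<le> d x \<and> d x < t}"
      using bdd by (rule bounded_subset) (use t s in auto)
    from perimeter_sublevel_shell[OF lip L K this t(1)]
    obtain \<delta> where \<delta>: "0 < \<delta>"
      "\<And>\<epsilon>. 0 < \<epsilon> \<Longrightarrow> \<epsilon> < \<delta> \<Longrightarrow> K * \<epsilon> \<le> n * L * measure lborel {x. t - 3 * \<epsilon> \<le> d x \<and> d x < t}"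
      unfolding n_def by blast
    show "\<exists>\<delta>>0. \<forall>\<epsilon>. 0 < \<epsilon> \<and> \<epsilon> < \<delta> \<and> - s \<le> t - \<epsilon> \<longrightarrow> K / (3 * n * L) * \<epsilon> \<le> F t - F (t - \<epsilon>)"
    \<comment> \<open>The shell estimate is applied with \<open>\<epsilon> / 3\<close>, which makes
      its shell exactly the one whose volume is the increment of \<open>F\<close>. This accounts for
      the threshold \<open>3 * \<delta>\<close> and the 3 in the slope.\<close>
    proof (intro exI[of _ "3 * \<delta>"] conjI allI impI)
      fix \<epsilon> assume \<epsilon>: "0 < \<epsilon> \<and> \<epsilon> < 3 * \<delta> \<and> - s \<le> t - \<epsilon>"
      have "{x. - s \<le> d x \<and> d x < t} = {x. - s \<le> d x \<and> d x < t - \<epsilon>} \<union> {x. t - \<epsilon> \<le> d x \<and> d x < t}"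
        using \<epsilon> by auto
      then have "F t = F (t - \<epsilon>) + measure lborel {x. t - \<epsilon> \<le> d x \<and> d x < t}"
        unfolding F_def using \<epsilon> t s fin[of "- s" "t - \<epsilon>"] fin[of "t - \<epsilon>" t]
        by (simp only:) (rule measure_Union, auto simp: fmeasurable_def)
      moreover have "K * (\<epsilon> / 3) \<le> n * L * measure lborel {x. t - \<epsilon> \<le> d x \<and> d x < t}"
        using \<delta>(2)[of "\<epsilon> / 3"] \<epsilon> by simp
      ultimately show "K / (3 * n * L) * \<epsilon> \<le> F t - F (t - \<epsilon>)"
        using n L by (simp add: field_simps)
    qed (use \<delta> in auto)
  qed (use s mono in auto)
  also have "F (- (s / 2)) - F (- s) \<le> F 0"
    using mono[of "- (s / 2)" 0] s measure_nonneg[of lborel "{x. - s \<le> d x \<and> d x < - s}"]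
    unfolding F_def by linarith
  \<comment> \<open>The 12 collects the 3 from the shell thickness, a 2 from \<open>K\<close>, and a
    2 from the interval length \<open>s / 2\<close>.\<close>
  also have "K / (3 * n * L) * (- (s / 2) - (- s)) = C / (12 * n * L) * s powr (1 - \<sigma>)"
    using s by (simp add: K_def powr_diff field_simps)
  finally show ?thesis by (simp add: F_def n_def)
qed

subsection \<open>Signed distance and parallel sets\<close>

lemma edist_set_eq_infdist:
  assumes "A \<noteq> {}"
  shows "edist_set x A = ereal (infdist x A)"
proof -
  have "ereal (INF y\<in>A. dist x y) = (INF y\<in>A. ereal (dist x y))"
    using ereal_Inf'[of "dist x ` A"] assms by (simp add: image_comp)
  then show ?thesis using assms by (simp add: edist_set_def infdist_def)
qed

text \<open>Since \<open>infdist\<close> to the empty set is 0, this agrees with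
  \<open>signed_dist\<close> only when \<open>A\<close> and its complement are both
  nonempty.\<close>

definition real_signed_dist :: "'a::metric_space set \<Rightarrow> 'a \<Rightarrow> real" where
  "real_signed_dist A x = infdist x A - infdist x (- A)"

lemma signed_dist_eq_real:
  assumes "A \<noteq> {}" "A \<noteq> UNIV"
  shows "signed_dist x A = ereal (real_signed_dist A x)"
proof -
  have "- A \<noteq> {}" using assms(2) by auto
  then show ?thesis
    using assms(1) by (simp add: signed_dist_def real_signed_dist_def edist_set_eq_infdist)
qed

text \<open>Each of the two distances is 1-Lipschitz. The constant 2 enters the shell estimate only
  as a numerical factor.\<close>

lemma real_signed_dist_lipschitz:
  "\<bar>real_signed_dist A x - real_signed_dist A y\<bar> \<le> 2 * dist x y"
  using infdist_triangle_abs[of x A y] infdist_triangle_abs[of x "- A" y]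
  unfolding real_signed_dist_def by linarith

text \<open>On an open set the distance to the nonempty complement is positive; off the set that
  distance is 0, so the value is nonnegative.\<close>

lemma real_signed_dist_neg_iff:
  assumes "open A" "A \<noteq> UNIV"
  shows "real_signed_dist A x < 0 \<longleftrightarrow> x \<in> A"
proof
  assume "x \<in> A"
  moreover have "0 < infdist x (- A)"
    using assms \<open>x \<in> A\<close> by (intro infdist_pos_not_in_closed) auto
  ultimately show "real_signed_dist A x < 0" by (simp add: real_signed_dist_def)
next
  assume "real_signed_dist A x < 0"
  then show "x \<in> A"
    using infdist_nonneg[of x A] by (cases "x \<in> A") (auto simp: real_signed_dist_def)
qed

text \<open>Points outside a nonempty closed set have positive distance to it, while points of the
  set contribute only the nonpositive term.\<close>

lemma real_signed_dist_nonpos_iff: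
  assumes "closed A" "A \<noteq> {}"
  shows "real_signed_dist A x \<le> 0 \<longleftrightarrow> x \<in> A"
proof
  assume "x \<in> A"
  then show "real_signed_dist A x \<le> 0"
    using infdist_nonneg[of x "- A"] by (simp add: real_signed_dist_def)
next
  assume "real_signed_dist A x \<le> 0"
  then show "x \<in> A"
    using infdist_pos_not_in_closed[OF assms, of x]
    by (cases "x \<in> A") (auto simp: real_signed_dist_def)
qed

lemma bounded_real_signed_dist_le:
  assumes "bounded A" "A \<noteq> {}"
  shows "bounded {x. real_signed_dist A x \<le> s}"
proof -
  obtain c R where R: "\<And>y. y \<in> A \<Longrightarrow> dist c y \<le> R"
    using assms(1) unfolding bounded_def by blast
  have "dist c x \<le> R + max s 0 + 1" if "real_signed_dist A x \<le> s" for x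
  proof -
    have "infdist x A \<le> max s 0"
      using that by (cases "x \<in> A") (auto simp: real_signed_dist_def)
    \<comment> \<open>The distance need not be attained in \<open>A\<close>; the slack 1 yields an
      actual point of \<open>A\<close> nearby.\<close>
    then have "infdist x A < max s 0 + 1" by simp
    then obtain y where "y \<in> A" "dist x y < max s 0 + 1"
      using assms(2) by (auto simp: infdist_def cINF_less_iff split: if_splits)
    then show ?thesis
      using R[of y] dist_triangle[of c x y] by (simp add: dist_commute)
  qed
  then show ?thesis unfolding bounded_def by blast
qed

text \<open>With infinite distance to the empty set, all parallel sets of the empty set are empty,
  and likewise those of the whole space are the whole space. A positive perimeter therefore rules
  out both cases.\<close>

lemma signed_dist_empty: "signed_dist x {} = \<infinity>"
proof -
  have "signed_dist x {} = \<infinity> - ereal (infdist x UNIV)"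
    using edist_set_eq_infdist[of UNIV x] by (simp add: signed_dist_def edist_set_def top_ereal_def)
  then show ?thesis by simp
qed

lemma signed_dist_UNIV: "signed_dist x UNIV = - \<infinity>"
proof -
  have "signed_dist x UNIV = ereal (infdist x UNIV) - \<infinity>"
    using edist_set_eq_infdist[of UNIV x] by (simp add: signed_dist_def edist_set_def top_ereal_def)
  then show ?thesis by simp
qed

text \<open>Once the infimum of \<open>u\<close> over the exterior of a ball exceeds
  \<open>h\<close>, the sublevel set is contained in that ball.\<close>

lemma bounded_closed_sublevel:
  fixes u :: "'a::real_normed_vector \<Rightarrow> real"
  assumes lim: "((\<lambda>R::real. INF y\<in>{y. R \<le> norm y}. ereal (u y)) \<longlongrightarrow> L) at_top"
    and "ereal h < L"
  shows "bounded (closed_sublevel u h)"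
proof -
  have "\<forall>\<^sub>F R in at_top. ereal h < (INF y\<in>{y. (R::real) \<le> norm y}. ereal (u y))"
    using lim assms(2) by (rule order_tendstoD)
  then obtain R :: real where R: "ereal h < (INF y\<in>{y. R \<le> norm y}. ereal (u y))"
    using eventually_happens by fastforce
  have "norm y \<le> R" if "u y \<le> h" for y
  proof (rule ccontr)
    assume "\<not> norm y \<le> R"
    then have "(INF y\<in>{y. R \<le> norm y}. ereal (u y)) \<le> ereal (u y)"
      by (intro INF_lower) auto
    also have "\<dots> \<le> ereal h" using that by simp
    finally show False using R by simp
  qed
  then show ?thesis unfolding bounded_iff closed_sublevel_def by blast
qed

section \<open>Weighted mass of parallel sets\<close>

lemma set_integral_ge_measure:
  fixes \<Theta> :: "'a::euclidean_space \<Rightarrow> real"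
  assumes \<Theta>: "integrable lebesgue \<Theta>"
    and B: "B \<in> sets borel" "bounded B"
    and c: "\<And>x. x \<in> B \<Longrightarrow> c \<le> \<Theta> x"
  shows "c * measure lborel B \<le> (LINT x:B|lebesgue. \<Theta> x)"
proof -
  have Bl: "B \<in> sets lebesgue" using B(1) by simp
  have "emeasure lebesgue B < \<infinity>"
    using emeasure_bounded_finite[OF B(2)] B(1) by simp
  then have i: "integrable lebesgue (\<lambda>x. c * indicator B x :: real)"
    using Bl by (intro integrable_mult_right integrable_real_indicator)
  have "c * measure lebesgue B = (LINT x|lebesgue. c * indicator B x)"
    using Bl by simp
  also have "\<dots> \<le> (LINT x|lebesgue. indicator B x *\<^sub>R \<Theta> x)"
    by (intro integral_mono i integrable_mult_indicator[OF Bl \<Theta>])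
      (use c in \<open>auto simp: indicator_def\<close>)
  also have "measure lebesgue B = measure lborel B"
    using B(1) by simp
  finally show ?thesis unfolding set_lebesgue_integral_def .
qed

lemma set_integral_Un_ge_measure:
  fixes \<Theta> :: "'a::euclidean_space \<Rightarrow> real"
  assumes \<Theta>: "integrable lebesgue \<Theta>"
    and S: "S \<in> sets borel" and B: "B \<in> sets borel" "bounded B" and disj: "S \<inter> B = {}"
    and c: "\<And>x. x \<in> B \<Longrightarrow> c \<le> \<Theta> x"
  shows "(LINT x:S|lebesgue. \<Theta> x) + c * measure lborel B \<le> (LINT x:S \<union> B|lebesgue. \<Theta> x)"
proof -
  have "set_integrable lebesgue X \<Theta>" if "X \<in> sets borel" for X
    unfolding set_integrable_def using that by (intro integrable_mult_indicator[OF _ \<Theta>]) simp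
  then have "(LINT x:S \<union> B|lebesgue. \<Theta> x) = (LINT x:S|lebesgue. \<Theta> x) + (LINT x:B|lebesgue. \<Theta> x)"
    using S B disj by (intro set_integral_Un)
  then show ?thesis using set_integral_ge_measure[OF \<Theta> B c] by simp
qed

lemma borel_measurable_real_signed_dist:
  fixes A :: "'a::euclidean_space set"
  shows "real_signed_dist A \<in> borel_measurable borel"
  unfolding real_signed_dist_def
  by (intro borel_measurable_continuous_onI continuous_intros)

text \<open>The empty set and the whole space have infinite signed distance and are treated apart;
  otherwise the sets are sublevels of a Borel function.\<close>

lemma sets_lebesgue_signed_dist:
  fixes A :: "'a::euclidean_space set"
  shows "{x. signed_dist x A < ereal s} \<in> sets lebesgue"
    and "{x. signed_dist x A \<le> ereal s} \<in> sets lebesgue"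
proof -
  have *: "{x. signed_dist x A < ereal s} \<in> sets borel \<and> {x. signed_dist x A \<le> ereal s} \<in> sets borel"
  proof (cases "A = {} \<or> A = UNIV")
    case True
    then show ?thesis by (auto simp: signed_dist_empty signed_dist_UNIV)
  next
    case False
    have [measurable]: "real_signed_dist A \<in> borel_measurable borel"
      by (rule borel_measurable_real_signed_dist)
    show ?thesis using False by (simp add: signed_dist_eq_real) measurable
  qed
  then show "{x. signed_dist x A < ereal s} \<in> sets lebesgue"
    "{x. signed_dist x A \<le> ereal s} \<in> sets lebesgue" by simp_all
qed

text \<open>The set \<open>A\<close> is its inner parallel set together with the shell where the
  signed distance lies in [-s,0). That shell stays in the bounded set \<open>A\<close>, so one lower
  bound for \<open>\<Theta>\<close> turns its volume into mass for all \<open>s\<close> at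
  once.\<close>

lemma open_parallel_mass:
  fixes A :: "(real ^ 'n) set" and \<Theta> :: "real ^ 'n \<Rightarrow> real"
  assumes A: "open A" "A = UNIV \<or> bounded A"
    and \<Theta>: "integrable lebesgue \<Theta>" "\<And>B. bounded B \<Longrightarrow> \<exists>c>0. \<forall>x\<in>B. c \<le> \<Theta> x"
    and C: "0 < C" "0 < s\<^sub>0" "0 < \<sigma>"
    and per: "\<And>t. - s\<^sub>0 \<le> t \<Longrightarrow> t < 0 \<Longrightarrow>
      ereal (C / (- t) powr \<sigma>) \<le> perimeter {x. signed_dist x A < ereal t}"
  shows "\<exists>c>0. \<forall>s. 0 < s \<and> s \<le> s\<^sub>0 \<longrightarrow>
    (LINT x:{x. signed_dist x A < ereal (- s)}|lebesgue. \<Theta> x) + c * s powr (1 - \<sigma>)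
      \<le> (LINT x:A|lebesgue. \<Theta> x)"
proof -
  \<comment> \<open>A single parameter with positive perimeter excludes the empty set and the whole
    space, whose parallel sets have perimeter at most 0.\<close>
  have pos: "\<not> perimeter {x. signed_dist x A < ereal (- s\<^sub>0)} \<le> 0"
  proof
    assume "perimeter {x. signed_dist x A < ereal (- s\<^sub>0)} \<le> 0"
    moreover have "ereal (C / s\<^sub>0 powr \<sigma>) \<le> perimeter {x. signed_dist x A < ereal (- s\<^sub>0)}"
      using per[of "- s\<^sub>0"] C by simp
    ultimately have "ereal (C / s\<^sub>0 powr \<sigma>) \<le> 0" by (rule order_trans[rotated])
    moreover have "0 < C / s\<^sub>0 powr \<sigma>" using C by simp
    ultimately show False by (simp add: zero_ereal_def)
  qed
  have ne: "A \<noteq> {}" "A \<noteq> UNIV"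
    using pos perimeter_empty_le perimeter_UNIV_le
    by (auto simp: signed_dist_empty signed_dist_UNIV)
  then have "bounded A" using A(2) by simp
  define d where "d = real_signed_dist A"
  have [measurable]: "d \<in> borel_measurable borel"
    unfolding d_def by (rule borel_measurable_real_signed_dist)
  have sd: "signed_dist x A = ereal (d x)" for x
    unfolding d_def by (rule signed_dist_eq_real[OF ne])
  have dA: "d x < 0 \<longleftrightarrow> x \<in> A" for x
    unfolding d_def by (rule real_signed_dist_neg_iff[OF A(1) ne(2)])
  obtain c where c: "0 < c" "\<And>x. x \<in> A \<Longrightarrow> c \<le> \<Theta> x"
    using \<Theta>(2)[OF \<open>bounded A\<close>] by blast
  \<comment> \<open>The constant of \<open>perimeter_shell_measure\<close> for the Lipschitz
    constant 2.\<close>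
  define k where "k = C / (12 * real CARD('n) * 2)"
  have "0 < k" using C by (simp add: k_def)
  have "(LINT x:{x. d x < - s}|lebesgue. \<Theta> x) + c * k * s powr (1 - \<sigma>)
      \<le> (LINT x:A|lebesgue. \<Theta> x)" if s: "0 < s" "s \<le> s\<^sub>0" for s
  proof -
    define B where "B = {x. - s \<le> d x \<and> d x < 0}"
    have B: "B \<subseteq> A" by (auto simp: B_def dA)
    then have "bounded B" using \<open>bounded A\<close> bounded_subset by blast
    have "k * s powr (1 - \<sigma>) \<le> measure lborel B"
      unfolding k_def B_def
    proof (rule perimeter_shell_measure)
      show "\<bar>d x - d y\<bar> \<le> 2 * dist x y" for x y
        unfolding d_def by (rule real_signed_dist_lipschitz)
      show "ereal (C / (- t) powr \<sigma>) \<le> perimeter {x. d x < t}" if "- s \<le> t" "t < 0" for t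
        using per[of t] that s by (simp add: sd)
    qed (use C s \<open>bounded B\<close> in \<open>auto simp: B_def\<close>)
    moreover have "(LINT x:{x. d x < - s}|lebesgue. \<Theta> x) + c * measure lborel B
        \<le> (LINT x:{x. d x < - s} \<union> B|lebesgue. \<Theta> x)"
    proof (rule set_integral_Un_ge_measure[OF \<Theta>(1)])
      show "{x. d x < - s} \<in> sets borel" "B \<in> sets borel" unfolding B_def by measurable
    qed (use B c \<open>bounded B\<close> in \<open>auto simp: B_def\<close>)
    moreover have "{x. d x < - s} \<union> B = A" using s by (auto simp: B_def simp flip: dA)
    ultimately show ?thesis
      using mult_left_mono[OF _ less_imp_le[OF c(1)], of "k * s powr (1 - \<sigma>)" "measure lborel B"]
      by (simp add: mult.assoc)
  qed
  then show ?thesis using c(1) \<open>0 < k\<close> by (intro exI[of _ "c * k"]) (simp add: sd)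
qed

text \<open>Passing to complements turns \<open>sd\<close> into \<open>- sd\<close> without changing the perimeter, so the shell outside
  a closed set is handled by the same estimate as the shell inside an open one.\<close>

lemma closed_parallel_mass:
  fixes A :: "(real ^ 'n) set" and \<Theta> :: "real ^ 'n \<Rightarrow> real"
  assumes A: "closed A" "A = UNIV \<or> bounded A"
    and \<Theta>: "integrable lebesgue \<Theta>" "\<And>B. bounded B \<Longrightarrow> \<exists>c>0. \<forall>x\<in>B. c \<le> \<Theta> x"
    and C: "0 < C" "0 < s\<^sub>0" "0 < \<sigma>"
    and per: "\<And>t. 0 < t \<Longrightarrow> t \<le> s\<^sub>0 \<Longrightarrow>
      ereal (C / t powr \<sigma>) \<le> perimeter {x. signed_dist x A \<le> ereal t}"
  shows "\<exists>c>0. \<forall>s. 0 < s \<and> s \<le> s\<^sub>0 \<longrightarrow>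
    (LINT x:A|lebesgue. \<Theta> x) + c * s powr (1 - \<sigma>)
      \<le> (LINT x:{x. signed_dist x A \<le> ereal s}|lebesgue. \<Theta> x)"
proof -
  have pos: "\<not> perimeter {x. signed_dist x A \<le> ereal s\<^sub>0} \<le> 0"
  proof
    assume "perimeter {x. signed_dist x A \<le> ereal s\<^sub>0} \<le> 0"
    moreover have "ereal (C / s\<^sub>0 powr \<sigma>) \<le> perimeter {x. signed_dist x A \<le> ereal s\<^sub>0}"
      using per[of s\<^sub>0] C by simp
    ultimately have "ereal (C / s\<^sub>0 powr \<sigma>) \<le> 0" by (rule order_trans[rotated])
    moreover have "0 < C / s\<^sub>0 powr \<sigma>" using C by simp
    ultimately show False by (simp add: zero_ereal_def)
  qed
  have ne: "A \<noteq> {}" "A \<noteq> UNIV"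
    using pos perimeter_empty_le perimeter_UNIV_le
    by (auto simp: signed_dist_empty signed_dist_UNIV)
  then have "bounded A" using A(2) by simp
  define d where "d x = - real_signed_dist A x" for x
  have [measurable]: "d \<in> borel_measurable borel"
    unfolding d_def using borel_measurable_real_signed_dist[of A] by measurable
  have sd: "signed_dist x A = ereal (- d x)" for x
    unfolding d_def using signed_dist_eq_real[OF ne] by simp
  have dA: "0 \<le> d x \<longleftrightarrow> x \<in> A" for x
    unfolding d_def using real_signed_dist_nonpos_iff[OF A(1) ne(1), of x] by simp
  have bdd: "bounded {x. - s \<le> d x}" for s
    using bounded_real_signed_dist_le[OF \<open>bounded A\<close> ne(1), of s] by (simp add: d_def)
  \<comment> \<open>The outer shells leave \<open>A\<close>, so the density is bounded below on the
    largest neighbourhood, which contains the shells of all smaller widths.\<close>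
  obtain c where c: "0 < c" "\<And>x. - s\<^sub>0 \<le> d x \<Longrightarrow> c \<le> \<Theta> x"
    using \<Theta>(2)[OF bdd[of s\<^sub>0]] by blast
  define k where "k = C / (12 * real CARD('n) * 2)"
  have "0 < k" using C by (simp add: k_def)
  have "(LINT x:A|lebesgue. \<Theta> x) + c * k * s powr (1 - \<sigma>)
      \<le> (LINT x:{x. - d x \<le> s}|lebesgue. \<Theta> x)" if s: "0 < s" "s \<le> s\<^sub>0" for s
  proof -
    define B where "B = {x. - s \<le> d x \<and> d x < 0}"
    have "bounded B" using bdd[of s] by (rule bounded_subset) (auto simp: B_def)
    have "k * s powr (1 - \<sigma>) \<le> measure lborel B"
      unfolding k_def B_def
    proof (rule perimeter_shell_measure)
      show "\<bar>d x - d y\<bar> \<le> 2 * dist x y" for x y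
        unfolding d_def using real_signed_dist_lipschitz[of A x y] by linarith
      show "ereal (C / (- t) powr \<sigma>) \<le> perimeter {x. d x < t}" if "- s \<le> t" "t < 0" for t
      proof -
        have "ereal (C / (- t) powr \<sigma>) \<le> perimeter {x. - d x \<le> - t}"
          using per[of "- t"] that s by (simp add: sd)
        also have "\<dots> \<le> perimeter (- {x. - d x \<le> - t})"
          by (rule perimeter_Compl_le) measurable
        also have "- {x. - d x \<le> - t} = {x. d x < t}" by auto
        finally show ?thesis .
      qed
    qed (use C s \<open>bounded B\<close> in \<open>auto simp: B_def\<close>)
    moreover have "(LINT x:A|lebesgue. \<Theta> x) + c * measure lborel B
        \<le> (LINT x:A \<union> B|lebesgue. \<Theta> x)"
    proof (rule set_integral_Un_ge_measure[OF \<Theta>(1)])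
      show "A \<in> sets borel" using A(1) by simp
      show "B \<in> sets borel" unfolding B_def by measurable
      show "A \<inter> B = {}" by (auto simp: B_def simp flip: dA)
    qed (use s c \<open>bounded B\<close> in \<open>auto simp: B_def\<close>)
    moreover have "A \<union> B = {x. - d x \<le> s}"
      using s by (auto simp: B_def simp flip: dA)
    ultimately show ?thesis
      using mult_left_mono[OF _ less_imp_le[OF c(1)], of "k * s powr (1 - \<sigma>)" "measure lborel B"]
      by (simp add: mult.assoc)
  qed
  then show ?thesis using c(1) \<open>0 < k\<close> by (intro exI[of _ "c * k"]) (simp add: sd)
qed

section \<open>From mass to the growth of the velocity\<close>

text \<open>Near \<open>q\<^sub>0\<close> the linearization error is at most half of the linear
  term, which leaves slope \<open>D / 2\<close> on each side. The derivative is taken within the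
  half-line, so \<open>q\<^sub>0 = 0\<close> is included.\<close>

lemma positive_derivative_gain:
  fixes g :: "real \<Rightarrow> real"
  assumes der: "(g has_real_derivative D) (at q\<^sub>0 within {0..})" and "0 < D"
  obtains \<delta> where "0 < \<delta>"
    "\<And>q. 0 \<le> q \<Longrightarrow> q \<le> q\<^sub>0 \<Longrightarrow> q\<^sub>0 - q < \<delta> \<Longrightarrow> g q \<le> g q\<^sub>0 - D / 2 * (q\<^sub>0 - q)"
    "\<And>q. 0 \<le> q \<Longrightarrow> q\<^sub>0 \<le> q \<Longrightarrow> q - q\<^sub>0 < \<delta> \<Longrightarrow> g q\<^sub>0 + D / 2 * (q - q\<^sub>0) \<le> g q"
proof -
  have "\<forall>e>0. \<exists>\<delta>>0. \<forall>q\<in>{0..}. norm (q - q\<^sub>0) < \<delta> \<longrightarrow>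
      norm (g q - g q\<^sub>0 - D * (q - q\<^sub>0)) \<le> e * norm (q - q\<^sub>0)"
    using der unfolding has_field_derivative_def has_derivative_within_alt by simp
  moreover have "0 < D / 2" using \<open>0 < D\<close> by simp
  ultimately obtain \<delta> where \<delta>: "0 < \<delta>" "\<And>q. 0 \<le> q \<Longrightarrow> \<bar>q - q\<^sub>0\<bar> < \<delta> \<Longrightarrow>
      \<bar>g q - g q\<^sub>0 - D * (q - q\<^sub>0)\<bar> \<le> D / 2 * \<bar>q - q\<^sub>0\<bar>"
    by (metis atLeast_iff real_norm_def)
  show thesis
  proof
    show "g q \<le> g q\<^sub>0 - D / 2 * (q\<^sub>0 - q)" if "0 \<le> q" "q \<le> q\<^sub>0" "q\<^sub>0 - q < \<delta>" for q
      using abs_le_D1[OF \<delta>(2)[of q]] that by (simp add: field_simps)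
    show "g q\<^sub>0 + D / 2 * (q - q\<^sub>0) \<le> g q" if "0 \<le> q" "q\<^sub>0 \<le> q" "q - q\<^sub>0 < \<delta>" for q
      using abs_le_D2[OF \<delta>(2)[of q]] that by (simp add: field_simps)
  qed (rule \<delta>(1))
qed

text \<open>For small \<open>s\<close> the guaranteed change of mass falls within the range where
  the linearization of \<open>f\<close> holds.\<close>

lemma eventually_powr_less:
  assumes "0 < \<alpha>" "0 < s\<^sub>0" "0 < (\<delta>::real)"
  shows "\<forall>\<^sub>F s in at_right 0. 0 < s \<and> s \<le> s\<^sub>0 \<and> c * s powr \<alpha> < \<delta>"
proof -
  have "((\<lambda>s. c * s powr \<alpha>) \<longlongrightarrow> c * 0 powr \<alpha>) (at_right 0)"
    using assms(1)
    by (intro tendsto_mult tendsto_const tendsto_powr' tendsto_ident_at)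
      (auto simp: eventually_at_right_field intro!: exI[of _ 1])
  then have "\<forall>\<^sub>F s in at_right 0. c * s powr \<alpha> < \<delta>"
    by (rule order_tendstoD) (use assms in simp)
  moreover have "\<forall>\<^sub>F s in at_right 0. 0 < s \<and> s \<le> s\<^sub>0"
    using assms(2) by (auto simp: eventually_at_right_field intro!: exI[of _ s\<^sub>0])
  ultimately show ?thesis by eventually_elim simp
qed

theorem theorem3p3:
  fixes f :: "real \<Rightarrow> real \<Rightarrow> real"
    and \<mu> :: "(real ^ 'n) set \<Rightarrow> real"
    and \<Theta> :: "real ^ 'n \<Rightarrow> real"
    and u\<^sub>0 :: "real ^ 'n \<Rightarrow> real"
    and \<omega> :: "real \<Rightarrow> real"
    and fq :: "real \<Rightarrow> real"
    and hbar :: real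
  assumes A1_bounded: "bounded ((\<lambda>(r, q). f r q) ` (UNIV \<times> {0..}))"
    and A1_continuous: "continuous_on (UNIV \<times> {0..}) (\<lambda>(r, q). f r q)"
    and A1_modulus: "modulus_of_continuity \<omega>"
      "\<And>r q1 q2. 0 \<le> q1 \<Longrightarrow> 0 \<le> q2 \<Longrightarrow> \<bar>f r q1 - f r q2\<bar> \<le> \<omega> \<bar>q1 - q2\<bar>"
    and A2_fst: "\<And>r1 r2 q. r1 < r2 \<Longrightarrow> 0 \<le> q \<Longrightarrow> f r1 q \<le> f r2 q"
    and A2_snd: "\<And>r q1 q2. 0 \<le> q1 \<Longrightarrow> q1 < q2 \<Longrightarrow> f r q1 < f r q2"
    and A3_density: "integrable lebesgue \<Theta>" "\<And>x. 0 < \<Theta> x"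
    and A3_measure: "\<And>A. A \<in> sets lebesgue \<Longrightarrow> \<mu> A = (LINT x:A|lebesgue. \<Theta> x)"
    and A4_continuous: "uniformly_continuous_on UNIV u\<^sub>0"
    and A4_infinity:
      "\<exists>L. ((\<lambda>R::real. INF y\<in>{y. R \<le> norm y}. ereal (u\<^sub>0 y)) \<longlongrightarrow> L) at_top \<and>
           (\<forall>x. ereal (u\<^sub>0 x) < L)"
    and hbar: "f hbar (\<mu> (open_sublevel u\<^sub>0 hbar)) \<le> 0"
      "0 \<le> f hbar (\<mu> (closed_sublevel u\<^sub>0 hbar))"
    and density_lower_bound:
      "\<And>A. bounded A \<Longrightarrow> \<exists>c>0. ereal c \<le> (INF x\<in>A. ereal (\<Theta> x))"
    and f_C1: "\<And>q. 0 \<le> q \<Longrightarrow> (f hbar has_real_derivative fq q) (at q within {0..})"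
      "continuous_on {0..} fq"
  shows
    "((\<exists>C s\<^sub>0 \<sigma>. 0 < C \<and> 0 < s\<^sub>0 \<and> 0 < \<sigma> \<and> \<sigma> < 1 \<and>
         0 < fq (\<mu> (open_sublevel u\<^sub>0 hbar)) \<and>
         (\<forall>s. - s\<^sub>0 \<le> s \<and> s < 0 \<longrightarrow>
            ereal (C / (- s) powr \<sigma>) \<le> perimeter (parallel_D u\<^sub>0 hbar s))) \<longrightarrow>
      (\<exists>\<alpha> C'. 0 < \<alpha> \<and> \<alpha> < 1 \<and> 0 < C' \<and>
         Limsup (at_right 0)
           (\<lambda>s. ereal (f hbar (\<mu> (parallel_D u\<^sub>0 hbar (- s))) / s powr \<alpha>)) \<le> ereal (- C')))
     \<and>
     ((\<exists>C s\<^sub>0 \<sigma>. 0 < C \<and> 0 < s\<^sub>0 \<and> 0 < \<sigma> \<and> \<sigma> < 1 \<and>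
         0 < fq (\<mu> (closed_sublevel u\<^sub>0 hbar)) \<and>
         (\<forall>s. 0 < s \<and> s \<le> s\<^sub>0 \<longrightarrow>
            ereal (C / s powr \<sigma>) \<le> perimeter (parallel_E u\<^sub>0 hbar s))) \<longrightarrow>
      (\<exists>\<alpha> C'. 0 < \<alpha> \<and> \<alpha> < 1 \<and> 0 < C' \<and>
         ereal C' \<le> Liminf (at_right 0)
           (\<lambda>s. ereal (f hbar (\<mu> (parallel_E u\<^sub>0 hbar s)) / s powr \<alpha>))))"
proof (intro conjI impI)
  have cont: "continuous_on UNIV u\<^sub>0"
    using A4_continuous by (rule uniformly_continuous_imp_continuous)
  have "open_sublevel u\<^sub>0 hbar = u\<^sub>0 -` {..<hbar}" "closed_sublevel u\<^sub>0 hbar = u\<^sub>0 -` {..hbar}"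
    by (auto simp: open_sublevel_def closed_sublevel_def)
  then have op: "open (open_sublevel u\<^sub>0 hbar)" and cl: "closed (closed_sublevel u\<^sub>0 hbar)"
    using cont by (auto intro: open_vimage closed_vimage)
  have \<Theta>_low: "\<exists>c>0. \<forall>x\<in>B. c \<le> \<Theta> x" if "bounded B" for B
    using density_lower_bound[OF that] by (auto simp: le_INF_iff)
  obtain L where L: "((\<lambda>R::real. INF y\<in>{y. R \<le> norm y}. ereal (u\<^sub>0 y)) \<longlongrightarrow> L) at_top"
    "\<And>x. ereal (u\<^sub>0 x) < L"
    using A4_infinity by blast
  \<comment> \<open>The limit \<open>L\<close> at infinity lies strictly above every value of
    \<open>u\<^sub>0\<close>. Hence \<open>hbar\<close> is either below \<open>L\<close>, and the
    sublevel sets are bounded, or at least \<open>L\<close>, and they are everything.\<close>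
  have UNIV_or_bdd: "open_sublevel u\<^sub>0 hbar = UNIV \<and> closed_sublevel u\<^sub>0 hbar = UNIV
      \<or> bounded (open_sublevel u\<^sub>0 hbar) \<and> bounded (closed_sublevel u\<^sub>0 hbar)"
  proof (cases "ereal hbar < L")
    case True
    then have "bounded (closed_sublevel u\<^sub>0 hbar)"
      using bounded_closed_sublevel[OF L(1)] by blast
    moreover have "open_sublevel u\<^sub>0 hbar \<subseteq> closed_sublevel u\<^sub>0 hbar"
      by (auto simp: open_sublevel_def closed_sublevel_def)
    ultimately show ?thesis using bounded_subset by blast
  next
    case False
    then have "L \<le> ereal hbar" by simp
    then have "ereal (u\<^sub>0 x) < ereal hbar" for x
      by (rule less_le_trans[OF L(2)])
    then show ?thesis
      by (auto simp: open_sublevel_def closed_sublevel_def less_imp_le)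
  qed
  have f_mono: "f hbar q1 \<le> f hbar q2" if "0 \<le> q1" "q1 \<le> q2" for q1 q2
    using A2_snd[of q1 q2 hbar] that by (cases "q1 = q2") auto
  have \<mu>_nonneg: "0 \<le> \<mu> A" if "A \<in> sets lebesgue" for A
    unfolding A3_measure[OF that] set_lebesgue_integral_def
    by (intro Bochner_Integration.integral_nonneg)
      (use A3_density(2) in \<open>auto simp: indicator_def less_imp_le\<close>)
  define q\<^sub>D where "q\<^sub>D = \<mu> (open_sublevel u\<^sub>0 hbar)"
  define q\<^sub>E where "q\<^sub>E = \<mu> (closed_sublevel u\<^sub>0 hbar)"
  have q0: "0 \<le> q\<^sub>D" "0 \<le> q\<^sub>E"
    unfolding q\<^sub>D_def q\<^sub>E_def using op cl by (auto intro!: \<mu>_nonneg)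
  {
    assume "\<exists>C s\<^sub>0 \<sigma>. 0 < C \<and> 0 < s\<^sub>0 \<and> 0 < \<sigma> \<and> \<sigma> < 1 \<and>
         0 < fq (\<mu> (open_sublevel u\<^sub>0 hbar)) \<and>
         (\<forall>s. - s\<^sub>0 \<le> s \<and> s < 0 \<longrightarrow>
            ereal (C / (- s) powr \<sigma>) \<le> perimeter (parallel_D u\<^sub>0 hbar s))"
    then obtain C s\<^sub>0 \<sigma> where C: "0 < C" "0 < s\<^sub>0" "0 < \<sigma>" "\<sigma> < 1" and fq: "0 < fq q\<^sub>D"
      and per: "\<And>s. - s\<^sub>0 \<le> s \<Longrightarrow> s < 0 \<Longrightarrow>
        ereal (C / (- s) powr \<sigma>) \<le> perimeter (parallel_D u\<^sub>0 hbar s)"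
      unfolding q\<^sub>D_def by blast
    have "open_sublevel u\<^sub>0 hbar = UNIV \<or> bounded (open_sublevel u\<^sub>0 hbar)"
      using UNIV_or_bdd by blast
    from open_parallel_mass[OF op this A3_density(1) \<Theta>_low C(1-3) per[unfolded parallel_D_def]]
    obtain c where c: "0 < c" "\<And>s. 0 < s \<Longrightarrow> s \<le> s\<^sub>0 \<Longrightarrow>
        (LINT x:parallel_D u\<^sub>0 hbar (- s)|lebesgue. \<Theta> x) + c * s powr (1 - \<sigma>)
          \<le> (LINT x:open_sublevel u\<^sub>0 hbar|lebesgue. \<Theta> x)"
      unfolding parallel_D_def by blast
    have meas: "parallel_D u\<^sub>0 hbar s \<in> sets lebesgue" for s
      unfolding parallel_D_def by (intro sets_lebesgue_signed_dist)
    have mass: "\<mu> (parallel_D u\<^sub>0 hbar (- s)) \<le> q\<^sub>D - c * s powr (1 - \<sigma>)" if "0 < s" "s \<le> s\<^sub>0" for s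
      using c(2)[OF that] op unfolding q\<^sub>D_def by (simp add: A3_measure meas)
    obtain \<delta> where \<delta>: "0 < \<delta>"
      "\<And>q. 0 \<le> q \<Longrightarrow> q \<le> q\<^sub>D \<Longrightarrow> q\<^sub>D - q < \<delta> \<Longrightarrow> f hbar q \<le> f hbar q\<^sub>D - fq q\<^sub>D / 2 * (q\<^sub>D - q)"
      using positive_derivative_gain[OF f_C1(1)[OF q0(1)] fq] by metis
    have "\<forall>\<^sub>F s in at_right 0. 0 < s \<and> s \<le> s\<^sub>0 \<and> c * s powr (1 - \<sigma>) < \<delta>"
      using C \<delta>(1) by (intro eventually_powr_less) auto
    then have "\<forall>\<^sub>F s in at_right 0.
        ereal (f hbar (\<mu> (parallel_D u\<^sub>0 hbar (- s))) / s powr (1 - \<sigma>)) \<le> ereal (- (fq q\<^sub>D / 2 * c))"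
    proof eventually_elim
      case (elim s)
      \<comment> \<open>The linearization is used at this upper bound for the mass, which is known
        to be within \<open>\<delta>\<close> of \<open>q\<^sub>D\<close>; the mass itself may be
        much smaller, and monotonicity of \<open>f\<close> covers the difference.\<close>
      define q where "q = q\<^sub>D - c * s powr (1 - \<sigma>)"
      have q: "\<mu> (parallel_D u\<^sub>0 hbar (- s)) \<le> q" "0 \<le> \<mu> (parallel_D u\<^sub>0 hbar (- s))"
        using mass elim \<mu>_nonneg[OF meas] by (auto simp: q_def)
      have "f hbar (\<mu> (parallel_D u\<^sub>0 hbar (- s))) \<le> f hbar q"
        using q by (intro f_mono)
      also have "\<dots> \<le> f hbar q\<^sub>D - fq q\<^sub>D / 2 * (q\<^sub>D - q)"
        using \<delta>(2)[of q] q elim c(1) by (simp add: q_def)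
      \<comment> \<open>The sign of \<open>f\<close> at \<open>q\<^sub>D\<close>, given by the
        choice of \<open>hbar\<close>, discards the constant term, leaving a multiple of
        \<open>s powr (1 - \<sigma>)\<close>.\<close>
      also have "\<dots> \<le> - (fq q\<^sub>D / 2 * c) * s powr (1 - \<sigma>)"
        using hbar(1) by (simp add: q_def q\<^sub>D_def)
      finally show ?case using elim by (simp add: pos_divide_le_eq)
    qed
    then have "Limsup (at_right 0)
        (\<lambda>s. ereal (f hbar (\<mu> (parallel_D u\<^sub>0 hbar (- s))) / s powr (1 - \<sigma>))) \<le> ereal (- (fq q\<^sub>D / 2 * c))"
      by (rule Limsup_bounded)
    then show "\<exists>\<alpha> C'. 0 < \<alpha> \<and> \<alpha> < 1 \<and> 0 < C' \<and>
         Limsup (at_right 0)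
           (\<lambda>s. ereal (f hbar (\<mu> (parallel_D u\<^sub>0 hbar (- s))) / s powr \<alpha>)) \<le> ereal (- C')"
      using C fq c(1) by (intro exI[of _ "1 - \<sigma>"] exI[of _ "fq q\<^sub>D / 2 * c"]) simp
  next
    assume "\<exists>C s\<^sub>0 \<sigma>. 0 < C \<and> 0 < s\<^sub>0 \<and> 0 < \<sigma> \<and> \<sigma> < 1 \<and>
         0 < fq (\<mu> (closed_sublevel u\<^sub>0 hbar)) \<and>
         (\<forall>s. 0 < s \<and> s \<le> s\<^sub>0 \<longrightarrow>
            ereal (C / s powr \<sigma>) \<le> perimeter (parallel_E u\<^sub>0 hbar s))"
    then obtain C s\<^sub>0 \<sigma> where C: "0 < C" "0 < s\<^sub>0" "0 < \<sigma>" "\<sigma> < 1" and fq: "0 < fq q\<^sub>E"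
      and per: "\<And>s. 0 < s \<Longrightarrow> s \<le> s\<^sub>0 \<Longrightarrow>
        ereal (C / s powr \<sigma>) \<le> perimeter (parallel_E u\<^sub>0 hbar s)"
      unfolding q\<^sub>E_def by blast
    have "closed_sublevel u\<^sub>0 hbar = UNIV \<or> bounded (closed_sublevel u\<^sub>0 hbar)"
      using UNIV_or_bdd by blast
    from closed_parallel_mass[OF cl this A3_density(1) \<Theta>_low C(1-3) per[unfolded parallel_E_def]]
    obtain c where c: "0 < c" "\<And>s. 0 < s \<Longrightarrow> s \<le> s\<^sub>0 \<Longrightarrow>
        (LINT x:closed_sublevel u\<^sub>0 hbar|lebesgue. \<Theta> x) + c * s powr (1 - \<sigma>)
          \<le> (LINT x:parallel_E u\<^sub>0 hbar s|lebesgue. \<Theta> x)"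
      unfolding parallel_E_def by blast
    have meas: "parallel_E u\<^sub>0 hbar s \<in> sets lebesgue" for s
      unfolding parallel_E_def by (intro sets_lebesgue_signed_dist)
    have mass: "q\<^sub>E + c * s powr (1 - \<sigma>) \<le> \<mu> (parallel_E u\<^sub>0 hbar s)" if "0 < s" "s \<le> s\<^sub>0" for s
      using c(2)[OF that] cl unfolding q\<^sub>E_def by (simp add: A3_measure meas)
    obtain \<delta> where \<delta>: "0 < \<delta>"
      "\<And>q. 0 \<le> q \<Longrightarrow> q\<^sub>E \<le> q \<Longrightarrow> q - q\<^sub>E < \<delta> \<Longrightarrow> f hbar q\<^sub>E + fq q\<^sub>E / 2 * (q - q\<^sub>E) \<le> f hbar q"
      using positive_derivative_gain[OF f_C1(1)[OF q0(2)] fq] by metis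
    have "\<forall>\<^sub>F s in at_right 0. 0 < s \<and> s \<le> s\<^sub>0 \<and> c * s powr (1 - \<sigma>) < \<delta>"
      using C \<delta>(1) by (intro eventually_powr_less) auto
    then have "\<forall>\<^sub>F s in at_right 0.
        ereal (fq q\<^sub>E / 2 * c) \<le> ereal (f hbar (\<mu> (parallel_E u\<^sub>0 hbar s)) / s powr (1 - \<sigma>))"
    proof eventually_elim
      case (elim s)
      \<comment> \<open>Symmetrically, a lower bound for the mass that is close to
        \<open>q\<^sub>E\<close>; a larger mass only increases \<open>f\<close>.\<close>
      define q where "q = q\<^sub>E + c * s powr (1 - \<sigma>)"
      have q: "q \<le> \<mu> (parallel_E u\<^sub>0 hbar s)" "q\<^sub>E \<le> q"
        using mass elim c(1) by (auto simp: q_def)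
      have "fq q\<^sub>E / 2 * c * s powr (1 - \<sigma>) \<le> f hbar q\<^sub>E + fq q\<^sub>E / 2 * (q - q\<^sub>E)"
        using hbar(2) by (simp add: q_def q\<^sub>E_def)
      also have "\<dots> \<le> f hbar q"
        using \<delta>(2)[of q] q elim q0 by (simp add: q_def)
      also have "\<dots> \<le> f hbar (\<mu> (parallel_E u\<^sub>0 hbar s))"
        using q q0 by (intro f_mono) auto
      finally show ?case using elim by (simp add: pos_le_divide_eq)
    qed
    then have "ereal (fq q\<^sub>E / 2 * c) \<le> Liminf (at_right 0)
        (\<lambda>s. ereal (f hbar (\<mu> (parallel_E u\<^sub>0 hbar s)) / s powr (1 - \<sigma>)))"
      by (rule Liminf_bounded)
    then show "\<exists>\<alpha> C'. 0 < \<alpha> \<and> \<alpha> < 1 \<and> 0 < C' \<and>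
         ereal C' \<le> Liminf (at_right 0)
           (\<lambda>s. ereal (f hbar (\<mu> (parallel_E u\<^sub>0 hbar s)) / s powr \<alpha>))"
      using C fq c(1) by (intro exI[of _ "1 - \<sigma>"] exI[of _ "fq q\<^sub>E / 2 * c"]) simp
  }
qed

end
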